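(* Let $M$ and $N$ be matroids on disjoint finite sets $S$ and $T$, let $A\subseteq S$, $B\subseteq T$, and let $P=(M,N;A,B)$. Then $P$ is disconnected if and only if at least one of the following holds: (1) $P=M\oplus N$; (2) $M$ has loops or $N$ has coloops; (3) $A\neq\emptyset$ and $M$ has a separator $X$ with $A\subseteq X\subsetneq S$; (4) $B\neq\emptyset$ and $N$ has a nonempty separator $Y$ with $Y\cap B=\emptyset$.
   Context: A separator of a matroid $K$ on $E$ is a set $X\subseteq E$ with $r_K(X)+r_K(E-X)=r(K)$; $K$ is disconnected if it has a separator other than $\emptyset$ and $E$. The principal sum $(M,N;A,B)$ is the matroid union $M^+(A,B)\vee N_0$, where: $N_0=N\oplus U_{0,S}$ ($N$ with the elements of $S$ added as loops); $M^+(A,B)$ is the matroid on $S\cup T$ obtained from $M$ by adding each element of $B$ freely (by successive principal extensions) to the flat $\mathrm{cl}_M(A)$ and each element of $T-B$ as a loop, equivalently the matroid with rank function $r(X\cup Y)=\min\{r_M(X\cup A),\,r_M(X)+|Y\cap B|\}$ for $X\subseteq S$, $Y\subseteq T$; and the matroid union $G\vee H$ of matroids on a common set has as independent sets the unions of an independent set of $G$ and an independent set of $H$.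
   Formalization: The sets S and T are assumed nonempty; if S is empty and N is connected (e.g. N = U_{1,2}), then P = N = M⊕N, so (1) holds although P is connected (similarly if T is empty). *)

theory Defs
  imports Main
begin

text \<open>
  Set systems are the raw data of a matroid, so that two matroids are equal iff they have
  the same ground set and the same independent sets.
\<close>

record 'a set_system =
  ground :: "'a set"
  indeps :: "'a set set"

definition matroid :: "'a set_system \<Rightarrow> bool" where
  "matroid M \<longleftrightarrow>
     finite (ground M) \<and>
     indeps M \<subseteq> Pow (ground M) \<and>
     {} \<in> indeps M \<and>
     (\<forall>I J. I \<in> indeps M \<and> J \<subseteq> I \<longrightarrow> J \<in> indeps M) \<and>
     (\<forall>I J. I \<in> indeps M \<and> J \<in> indeps M \<and> card I < card J \<longrightarrow>
        (\<exists>x \<in> J - I. insert x I \<in> indeps M))"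

definition rank :: "'a set_system \<Rightarrow> 'a set \<Rightarrow> nat" where
  "rank M X = Max (card ` {I \<in> indeps M. I \<subseteq> X})"

definition basis :: "'a set_system \<Rightarrow> 'a set \<Rightarrow> bool" where
  "basis M I \<longleftrightarrow> I \<in> indeps M \<and> (\<forall>J \<in> indeps M. I \<subseteq> J \<longrightarrow> J = I)"

definition loop :: "'a set_system \<Rightarrow> 'a \<Rightarrow> bool" where
  "loop M e \<longleftrightarrow> e \<in> ground M \<and> {e} \<notin> indeps M"

definition coloop :: "'a set_system \<Rightarrow> 'a \<Rightarrow> bool" where
  "coloop M e \<longleftrightarrow> e \<in> ground M \<and> (\<forall>I. basis M I \<longrightarrow> e \<in> I)"

definition separator :: "'a set_system \<Rightarrow> 'a set \<Rightarrow> bool" where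
  "separator K X \<longleftrightarrow>
     X \<subseteq> ground K \<and> rank K X + rank K (ground K - X) = rank K (ground K)"

definition disconnected :: "'a set_system \<Rightarrow> bool" where
  "disconnected K \<longleftrightarrow> (\<exists>X. separator K X \<and> X \<noteq> {} \<and> X \<noteq> ground K)"

text \<open>Used only for matroids on disjoint ground sets.\<close>

definition direct_sum :: "'a set_system \<Rightarrow> 'a set_system \<Rightarrow> 'a set_system" where
  "direct_sum M N =
     \<lparr>ground = ground M \<union> ground N, indeps = {I \<union> J | I J. I \<in> indeps M \<and> J \<in> indeps N}\<rparr>"

text \<open>Used only for matroids on the same ground set.\<close>

definition matroid_union :: "'a set_system \<Rightarrow> 'a set_system \<Rightarrow> 'a set_system" where
  "matroid_union G H =
     \<lparr>ground = ground G \<union> ground H, indeps = {I \<union> J | I J. I \<in> indeps G \<and> J \<in> indeps H}\<rparr>"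

definition uniform_matroid :: "nat \<Rightarrow> 'a set \<Rightarrow> 'a set_system" where
  "uniform_matroid k E = \<lparr>ground = E, indeps = {I. I \<subseteq> E \<and> card I \<le> k}\<rparr>"

text \<open>
  A matroid with rank function \<open>r\<close> has as independent sets exactly the sets \<open>I\<close> with
  \<open>r I = |I|\<close>; hence this is the only matroid on \<open>E\<close> that can have rank function \<open>r\<close>.
\<close>

definition matroid_of_rank :: "'a set \<Rightarrow> ('a set \<Rightarrow> nat) \<Rightarrow> 'a set_system" where
  "matroid_of_rank E r = \<lparr>ground = E, indeps = {I. I \<subseteq> E \<and> r I = card I}\<rparr>"

text \<open>
  The matroid $M^+(A,B)$ on \<open>S \<union> T\<close>, where \<open>S\<close> is the ground set of \<open>M\<close> and \<open>T\<close> is disjoint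
  from \<open>S\<close>: each element of \<open>B\<close> is added freely to the flat spanned by \<open>A\<close>, and each element
  of \<open>T - B\<close> is added as a loop. For \<open>X \<subseteq> S\<close> and \<open>Y \<subseteq> T\<close> the rank of \<open>X \<union> Y\<close> is
  $\min\{r_M(X \cup A), r_M(X) + |Y \cap B|\}$; below, \<open>X = Z \<inter> S\<close> and \<open>Y = Z \<inter> T\<close>.
\<close>

definition free_extension ::
    "'a set_system \<Rightarrow> 'a set \<Rightarrow> 'a set \<Rightarrow> 'a set \<Rightarrow> 'a set_system" where
  "free_extension M T A B =
     matroid_of_rank (ground M \<union> T)
       (\<lambda>Z. min (rank M ((Z \<inter> ground M) \<union> A))
                (rank M (Z \<inter> ground M) + card ((Z \<inter> T) \<inter> B)))"

definition principal_sum ::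
    "'a set_system \<Rightarrow> 'a set_system \<Rightarrow> 'a set \<Rightarrow> 'a set \<Rightarrow> 'a set_system" where
  "principal_sum M N A B =
     matroid_union (free_extension M (ground N) A B)
                   (direct_sum N (uniform_matroid 0 (ground M)))"

end

theory Submission
  imports Defs
begin

text \<open>
  The restriction of \<open>P\<close> to \<open>S\<close> is \<open>M\<close> and its contraction by \<open>S\<close> is \<open>N\<close>, so a separator \<open>Z\<close>
  of \<open>P\<close> cuts out separators of \<open>M\<close> and of \<open>N\<close>. If (1)--(4) fail, then up to complementing
  \<open>Z\<close> there are $e \in A - Z$ and $b \in B \cap Z$. Take a basis \<open>I\<close> of \<open>M\<close> containing \<open>e\<close> and a
  basis \<open>J\<close> of \<open>N\<close> avoiding \<open>b\<close>, and put $C = (J \cap Z) \cup \{b\}$. Since \<open>b\<close> can replace \<open>e\<close> in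
  \<open>I\<close>, the set $(I - e) \cup C$ is independent in \<open>P\<close>; since \<open>Z\<close> separates \<open>e\<close> from \<open>C\<close>, so is
  $I \cup C$, whence \<open>C\<close> is independent in $P/S = N$ and \<open>b\<close> can be added to the basis \<open>J\<close>.
\<close>

section \<open>Independence, rank and separators\<close>

lemma matroidI:
  assumes "finite (ground M)" "\<And>I. I \<in> indeps M \<Longrightarrow> I \<subseteq> ground M" "{} \<in> indeps M"
    and "\<And>I J. I \<in> indeps M \<Longrightarrow> J \<subseteq> I \<Longrightarrow> J \<in> indeps M"
    and "\<And>I J. I \<in> indeps M \<Longrightarrow> J \<in> indeps M \<Longrightarrow> card I < card J \<Longrightarrow>
           \<exists>x \<in> J - I. insert x I \<in> indeps M"
  shows "matroid M"
  unfolding matroid_def using assms by blast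

lemma matroid_indep_subset_ground: "matroid M \<Longrightarrow> I \<in> indeps M \<Longrightarrow> I \<subseteq> ground M"
  by (auto simp: matroid_def)

lemma matroid_finite_indep: "matroid M \<Longrightarrow> I \<in> indeps M \<Longrightarrow> finite I"
  by (meson matroid_def matroid_indep_subset_ground finite_subset)

lemma matroid_empty: "matroid M \<Longrightarrow> {} \<in> indeps M"
  by (auto simp: matroid_def)

lemma matroid_indep_mono: "matroid M \<Longrightarrow> I \<in> indeps M \<Longrightarrow> J \<subseteq> I \<Longrightarrow> J \<in> indeps M"
  unfolding matroid_def by blast

lemma matroid_augment:
  assumes "matroid M" "I \<in> indeps M" "J \<in> indeps M" "card I < card J"
  obtains x where "x \<in> J - I" "insert x I \<in> indeps M"
proof -
  have "\<forall>I J. I \<in> indeps M \<and> J \<in> indeps M \<and> card I < card J \<longrightarrow>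
      (\<exists>x \<in> J - I. insert x I \<in> indeps M)"
    using assms(1) by (simp add: matroid_def)
  with assms(2-4) have "\<exists>x \<in> J - I. insert x I \<in> indeps M" by simp
  then show ?thesis using that by auto
qed

lemma matroid_finite_indeps: "matroid M \<Longrightarrow> finite (indeps M)"
  by (meson matroid_def finite_Pow_iff finite_subset)

section \<open>Rank and the extension of independent sets\<close>

lemma card_le_rank:
  assumes "matroid M" "I \<in> indeps M" "I \<subseteq> X"
  shows "card I \<le> rank M X"
  unfolding rank_def using assms matroid_finite_indeps[OF assms(1)] by (intro Max_ge) auto

lemma rank_attained:
  assumes "matroid M"
  obtains I where "I \<in> indeps M" "I \<subseteq> X" "card I = rank M X"
proof -
  have "rank M X \<in> card ` {I \<in> indeps M. I \<subseteq> X}"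
    unfolding rank_def using matroid_finite_indeps[OF assms] matroid_empty[OF assms]
    by (intro Max_in) auto
  then show ?thesis using that by auto
qed

lemma rank_le_card:
  assumes "matroid M" "finite X"
  shows "rank M X \<le> card X"
  by (metis rank_attained[OF assms(1), of X] card_mono[OF assms(2)])

lemma rank_mono:
  assumes "matroid M" "X \<subseteq> Y"
  shows "rank M X \<le> rank M Y"
  by (metis rank_attained[OF assms(1), of X] card_le_rank[OF assms(1)] assms(2) subset_trans)

text \<open>Augmentation from \<open>J\<close> adds one element at a time, so induction on the
  target size reaches every size up to \<open>card J\<close>.\<close>

lemma matroid_augment_to_card:
  assumes M: "matroid M" and I: "I \<in> indeps M" and J: "J \<in> indeps M" and le: "card I \<le> card J"
  obtains Q where "Q \<in> indeps M" "I \<subseteq> Q" "Q \<subseteq> I \<union> J" "card Q = card J"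
proof -
  have "\<exists>Q\<in>indeps M. I \<subseteq> Q \<and> Q \<subseteq> I \<union> J \<and> card Q = n" if "card I \<le> n" "n \<le> card J" for n
    using that
  proof (induction n rule: dec_induct)
    case base
    then show ?case using I by blast
  next
    case (step n)
    then obtain Q where Q: "Q \<in> indeps M" "I \<subseteq> Q" "Q \<subseteq> I \<union> J" "card Q = n"
      by auto
    with step.prems obtain x where x: "x \<in> J - Q" "insert x Q \<in> indeps M"
      using matroid_augment[OF M Q(1) J] by auto
    with Q have "card (insert x Q) = Suc n"
      using matroid_finite_indep[OF M Q(1)] by auto
    with x Q show ?case by (intro bexI[of _ "insert x Q"]) auto
  qed
  from this[OF le order_refl] show ?thesis using that by blast
qed

lemma indep_extend_rank:
  assumes M: "matroid M" and I: "I \<in> indeps M" "I \<subseteq> X"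
  obtains Q where "Q \<in> indeps M" "I \<subseteq> Q" "Q \<subseteq> X" "card Q = rank M X"
proof -
  obtain J where J: "J \<in> indeps M" "J \<subseteq> X" "card J = rank M X"
    using rank_attained[OF M] .
  with card_le_rank[OF M I] I obtain Q where "Q \<in> indeps M" "I \<subseteq> Q" "Q \<subseteq> I \<union> J" "card Q = card J"
    using matroid_augment_to_card[OF M I(1) J(1)] by metis
  with I J that show ?thesis by (metis Un_least subset_trans)
qed

lemma indep_maximal:
  assumes M: "matroid M" and Q: "Q \<in> indeps M" "card Q = rank M X"
    and x: "insert x Q \<in> indeps M" "insert x Q \<subseteq> X"
  shows "x \<in> Q"
proof (rule ccontr)
  assume "x \<notin> Q"
  then have "card (insert x Q) = Suc (card Q)"
    using matroid_finite_indep[OF M Q(1)] by simp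
  with card_le_rank[OF M x] Q show False by simp
qed

text \<open>\<open>basis\<close> asks for maximality under inclusion. An independent set of full
  rank has it, because an independent superset cannot be larger and hence is equal.\<close>

lemma basis_extend:
  assumes M: "matroid M" and I: "I \<in> indeps M"
  obtains D where "basis M D" "I \<subseteq> D"
proof -
  obtain D where D: "D \<in> indeps M" "I \<subseteq> D" "card D = rank M (ground M)"
    using indep_extend_rank[OF M I matroid_indep_subset_ground[OF M I]] by metis
  have "J = D" if "J \<in> indeps M" "D \<subseteq> J" for J
    using that D card_le_rank[OF M that(1) matroid_indep_subset_ground[OF M that(1)]]
      matroid_finite_indep[OF M that(1)]
    by (metis card_subset_eq card_mono le_antisym)
  with D that show ?thesis unfolding basis_def by blast
qed

text \<open>Some basis contains \<open>I\<close>, and every basis contains \<open>e\<close>.\<close>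

lemma coloop_insert_indep:
  assumes "matroid M" "coloop M e" "I \<in> indeps M"
  shows "insert e I \<in> indeps M"
proof -
  obtain D where D: "basis M D" "I \<subseteq> D"
    using basis_extend[OF assms(1,3)] .
  with assms(2) have "insert e I \<subseteq> D" by (auto simp: coloop_def)
  with D assms(1) show ?thesis by (meson basis_def matroid_indep_mono)
qed

text \<open>Enlarge \<open>I\<close> and \<open>J\<close> to maximal independent sets
  \<open>B1\<close> and \<open>B2\<close> of the two sides, extend \<open>B1\<close> to a basis
  \<open>Q\<close>, and enlarge \<open>B2\<close> from \<open>Q\<close> to full size. Every new
  element lies in \<open>X\<close> by maximality of \<open>B2\<close> and then in \<open>B1\<close>
  by maximality of \<open>B1\<close>; the rank equation forces all of \<open>B1\<close> to be
  used.\<close>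

lemma separator_Un_indep:
  assumes M: "matroid M" and sep: "separator M X"
    and I: "I \<in> indeps M" "I \<subseteq> X" and J: "J \<in> indeps M" "J \<subseteq> ground M - X"
  shows "I \<union> J \<in> indeps M"
proof -
  let ?E = "ground M"
  have X: "X \<subseteq> ?E" and r: "rank M X + rank M (?E - X) = rank M ?E"
    using sep by (auto simp: separator_def)
  obtain B1 where B1: "B1 \<in> indeps M" "I \<subseteq> B1" "B1 \<subseteq> X" "card B1 = rank M X"
    using indep_extend_rank[OF M I] .
  obtain B2 where B2: "B2 \<in> indeps M" "J \<subseteq> B2" "B2 \<subseteq> ?E - X" "card B2 = rank M (?E - X)"
    using indep_extend_rank[OF M J] .
  obtain Q where Q: "Q \<in> indeps M" "B1 \<subseteq> Q" "Q \<subseteq> ?E" "card Q = rank M ?E"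
    using indep_extend_rank[OF M B1(1)] B1(3) X by (metis subset_trans)
  have "card B2 \<le> card Q" using r B2(4) Q(4) by simp
  then obtain R where R: "R \<in> indeps M" "B2 \<subseteq> R" "R \<subseteq> B2 \<union> Q" "card R = card Q"
    using matroid_augment_to_card[OF M B2(1) Q(1)] by metis
  have "x \<in> B1" if x: "x \<in> R - B2" for x
  proof -
    have "x \<in> X"
    proof (rule ccontr)
      assume "x \<notin> X"
      then have "insert x B2 \<subseteq> ?E - X" using x R Q B2 by auto
      moreover have "insert x B2 \<in> indeps M"
        using matroid_indep_mono[OF M R(1)] x R by auto
      ultimately show False using indep_maximal[OF M B2(1,4)] x by blast
    qed
    moreover have "insert x B1 \<in> indeps M"
      using matroid_indep_mono[OF M Q(1)] x R Q by auto
    ultimately show ?thesis using indep_maximal[OF M B1(1,4)] B1 by blast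
  qed
  then have sub: "R - B2 \<subseteq> B1" by blast
  have "card (R - B2) = card B1"
    using R B2 B1 Q r matroid_finite_indep[OF M B2(1)] by (simp add: card_Diff_subset)
  then have "R - B2 = B1"
    using sub matroid_finite_indep[OF M B1(1)] card_subset_eq by metis
  with R(2) have "I \<union> J \<subseteq> R" using B1(2) B2(2) by auto
  then show ?thesis by (rule matroid_indep_mono[OF M R(1)])
qed

text \<open>This allows separators to be built from independent sets alone. Backwards, joining
  maximal independent sets of the two sides gives one inequality between ranks, and cutting a basis
  \<open>Q\<close> along \<open>X\<close> gives the other.\<close>

lemma separator_iff:
  assumes M: "matroid M"
  shows "separator M X \<longleftrightarrow> X \<subseteq> ground M \<and>
    (\<forall>I\<in>indeps M. \<forall>J\<in>indeps M. I \<subseteq> X \<longrightarrow> J \<subseteq> ground M - X \<longrightarrow> I \<union> J \<in> indeps M)"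
    (is "_ \<longleftrightarrow> ?R")
proof
  assume "separator M X"
  then show ?R
    using separator_Un_indep[OF M] by (auto simp: separator_def)
next
  let ?E = "ground M"
  assume R: ?R
  obtain I where I: "I \<in> indeps M" "I \<subseteq> X" "card I = rank M X"
    using rank_attained[OF M] .
  obtain J where J: "J \<in> indeps M" "J \<subseteq> ?E - X" "card J = rank M (?E - X)"
    using rank_attained[OF M] .
  obtain Q where Q: "Q \<in> indeps M" "Q \<subseteq> ?E" "card Q = rank M ?E"
    using rank_attained[OF M] .
  have "card (I \<union> J) = card I + card J"
    using matroid_finite_indep[OF M] I J by (intro card_Un_disjoint) auto
  moreover have "card (I \<union> J) \<le> rank M ?E"
    using R I J by (intro card_le_rank[OF M]) auto
  moreover have "card Q = card (Q \<inter> X) + card (Q - X)"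
    using matroid_finite_indep[OF M Q(1)] by (metis card_Int_Diff)
  moreover have "card (Q \<inter> X) \<le> rank M X" "card (Q - X) \<le> rank M (?E - X)"
    using Q by (auto intro!: card_le_rank[OF M] matroid_indep_mono[OF M Q(1)])
  ultimately show "separator M X"
    unfolding separator_def using R I J Q by auto
qed

lemma separator_Diff:
  assumes "separator M X"
  shows "separator M (ground M - X)"
  using assms by (auto simp: separator_def double_diff add.commute)

section \<open>Matroid union\<close>

text \<open>Only exchange is hard. With \<open>I\<close> and \<open>J\<close> each cut into disjoint
  parts for \<open>G\<close> and \<open>H\<close>, some part of \<open>J\<close> is larger than the
  matching part of \<open>I\<close>, and augmentation yields an element \<open>x\<close>. Either
  \<open>x\<close> is new to \<open>I\<close>, or it merely moves between the parts of
  \<open>I\<close>.\<close>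

lemma matroid_union_matroid:
  assumes G: "matroid G" and H: "matroid H"
  shows "matroid (matroid_union G H)"
proof (rule matroidI)
  show "finite (ground (matroid_union G H))"
    using G H by (auto simp: matroid_union_def matroid_def)
next
  fix I assume "I \<in> indeps (matroid_union G H)"
  then show "I \<subseteq> ground (matroid_union G H)"
    using matroid_indep_subset_ground[OF G] matroid_indep_subset_ground[OF H]
    by (fastforce simp: matroid_union_def)
next
  show "{} \<in> indeps (matroid_union G H)"
    using matroid_empty[OF G] matroid_empty[OF H] by (auto simp: matroid_union_def)
next
  fix I J assume "I \<in> indeps (matroid_union G H)" and JI: "J \<subseteq> I"
  then obtain I1 I2 where I: "I = I1 \<union> I2" "I1 \<in> indeps G" "I2 \<in> indeps H"
    by (auto simp: matroid_union_def)
  then have "J = (J \<inter> I1) \<union> (J \<inter> I2)" "J \<inter> I1 \<in> indeps G" "J \<inter> I2 \<in> indeps H"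
    using JI matroid_indep_mono[OF G] matroid_indep_mono[OF H] by auto
  then show "J \<in> indeps (matroid_union G H)"
    by (auto simp: matroid_union_def)
next
  fix I J
  assume "I \<in> indeps (matroid_union G H)" "J \<in> indeps (matroid_union G H)"
    and less: "card I < card J"
  then obtain I1 I2 J1 J2' where I: "I = I1 \<union> I2" "I1 \<in> indeps G" "I2 \<in> indeps H"
    and J': "J = J1 \<union> J2'" "J1 \<in> indeps G" "J2' \<in> indeps H"
    by (auto simp: matroid_union_def)
  \<comment> \<open>Disjoint parts make cardinalities additive; \<open>I\<close> is treated likewise
    at the end, through \<open>I2 - I1\<close>.\<close>
  define J2 where "J2 = J2' - J1"
  have J: "J = J1 \<union> J2" "J1 \<inter> J2 = {}" "J2 \<in> indeps H"
    using J' matroid_indep_mono[OF H J'(3)] by (auto simp: J2_def)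
  note J1 = J'(2)
  note fin = matroid_finite_indep[OF G] matroid_finite_indep[OF H]
  \<comment> \<open>Moving an element of \<open>J1\<close> from \<open>I2\<close> to \<open>I1\<close> increases the overlap with \<open>J1\<close> and, as
      \<open>J1\<close> and \<open>J2\<close> are disjoint, keeps that with \<open>J2\<close>; so the process terminates.\<close>
  have "\<exists>x\<in>J - I. \<exists>K1\<in>indeps G. \<exists>K2\<in>indeps H. insert x I = K1 \<union> K2"
    if "I = I1 \<union> I2" "I1 \<inter> I2 = {}" "I1 \<in> indeps G" "I2 \<in> indeps H" for I1 I2
    using that
  proof (induction "card (J1 - I1) + card (J2 - I2)" arbitrary: I1 I2 rule: less_induct)
    case less
    note I = less.prems
    have "card I = card I1 + card I2" "card J = card J1 + card J2"
      using I J J1 fin by (auto intro: card_Un_disjoint)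
    with \<open>card I < card J\<close> consider "card I1 < card J1" | "card I2 < card J2"
      by linarith
    then show ?case
    proof cases
      case 1
      then obtain x where x: "x \<in> J1 - I1" "insert x I1 \<in> indeps G"
        using matroid_augment[OF G I(3) J1] by auto
      show ?thesis
      proof (cases "x \<in> I2")
        case False
        then show ?thesis using x I J
          by (intro bexI[of _ x] bexI[of _ "insert x I1"] bexI[of _ I2]) auto
      next
        case True
        have "card (J1 - insert x I1) < card (J1 - I1)"
          using x fin J1 by (intro psubset_card_mono) auto
        moreover have "J2 - (I2 - {x}) = J2 - I2" using x J by auto
        ultimately have "card (J1 - insert x I1) + card (J2 - (I2 - {x}))
            < card (J1 - I1) + card (J2 - I2)" by simp
        moreover have "I2 - {x} \<in> indeps H"
          using matroid_indep_mono[OF H I(4)] by auto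
        ultimately show ?thesis
          using x True I by (intro less.hyps) auto
      qed
    next
      case 2
      then obtain x where x: "x \<in> J2 - I2" "insert x I2 \<in> indeps H"
        using matroid_augment[OF H I(4) J(3)] by auto
      show ?thesis
      proof (cases "x \<in> I1")
        case False
        then show ?thesis using x I J
          by (intro bexI[of _ x] bexI[of _ I1] bexI[of _ "insert x I2"]) auto
      next
        case True
        have "card (J2 - insert x I2) < card (J2 - I2)"
          using x fin J by (intro psubset_card_mono) auto
        moreover have "J1 - (I1 - {x}) = J1 - I1" using x J by auto
        ultimately have "card (J1 - (I1 - {x})) + card (J2 - insert x I2)
            < card (J1 - I1) + card (J2 - I2)" by simp
        moreover have "I1 - {x} \<in> indeps G"
          using matroid_indep_mono[OF G I(3)] by auto
        ultimately show ?thesis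
          using x True I by (intro less.hyps) auto
      qed
    qed
  qed
  from this[of I1 "I2 - I1"] I matroid_indep_mono[OF H I(3), of "I2 - I1"]
  show "\<exists>x\<in>J - I. insert x I \<in> indeps (matroid_union G H)"
    by (auto simp: matroid_union_def)
qed

section \<open>The free extension\<close>

lemma ground_free_extension: "ground (free_extension M T A B) = ground M \<union> T"
  by (simp add: free_extension_def matroid_of_rank_def)

text \<open>The second argument of \<open>min\<close> is at most \<open>card X + card Y\<close>,
  with equality exactly when \<open>X\<close> is independent and \<open>Y\<close> lies in
  \<open>B\<close>. The minimum equals this number iff, besides, the first argument is no
  smaller.\<close>

lemma indep_free_extension_iff:
  assumes M: "matroid M" and T: "finite T" "ground M \<inter> T = {}" and B: "B \<subseteq> T"
    and X: "X \<subseteq> ground M" and Y: "Y \<subseteq> T"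
  shows "X \<union> Y \<in> indeps (free_extension M T A B) \<longleftrightarrow>
    X \<in> indeps M \<and> Y \<subseteq> B \<and> card X + card Y \<le> rank M (X \<union> A)"
proof -
  have fX: "finite X" and fY: "finite Y"
    using M X Y T finite_subset by (auto simp: matroid_def)
  have eq: "(X \<union> Y) \<inter> ground M = X" "(X \<union> Y) \<inter> T = Y" using X Y T by auto
  have cU: "card (X \<union> Y) = card X + card Y"
    using X Y T fX fY by (intro card_Un_disjoint) auto
  have rX: "rank M X \<le> card X" using rank_le_card[OF M fX] .
  have cY: "card (Y \<inter> B) \<le> card Y" using fY by (intro card_mono) auto
  have "rank M X = card X \<longleftrightarrow> X \<in> indeps M"
  proof
    assume "rank M X = card X"
    then show "X \<in> indeps M"
      using rank_attained[OF M, of X] fX card_subset_eq by metis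
  next
    assume "X \<in> indeps M"
    then show "rank M X = card X" using card_le_rank[OF M _ order_refl] rX by force
  qed
  moreover have "card (Y \<inter> B) = card Y \<longleftrightarrow> Y \<subseteq> B"
    using fY by (metis card_subset_eq inf.orderE inf_le1 inf_le2)
  moreover have "X \<union> Y \<in> indeps (free_extension M T A B) \<longleftrightarrow>
      min (rank M (X \<union> A)) (rank M X + card (Y \<inter> B)) = card X + card Y"
    using X Y by (auto simp: free_extension_def matroid_of_rank_def eq cU)
  ultimately show ?thesis using rX cY by linarith
qed

text \<open>\<open>matroid_of_rank\<close> produces a set system from any function, so the axioms
  have to be checked, here through the bound
  \<open>card X + card Y \<le> rank M (X \<union> A)\<close>.\<close>

lemma free_extension_matroid:
  assumes M: "matroid M" and T: "finite T" "ground M \<inter> T = {}" and B: "B \<subseteq> T"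
  shows "matroid (free_extension M T A B)"
proof -
  let ?F = "free_extension M T A B"
  note iff = indep_free_extension_iff[OF M T B, of _ _ A]
  note gr = ground_free_extension[of M T A B]
  have split: "\<exists>X Y. I = X \<union> Y \<and> X \<subseteq> ground M \<and> Y \<subseteq> T \<and> X \<in> indeps M \<and> Y \<subseteq> B
      \<and> card X + card Y \<le> rank M (X \<union> A)" if "I \<in> indeps ?F" for I
  proof -
    have "I \<subseteq> ground M \<union> T"
      using that by (auto simp: free_extension_def matroid_of_rank_def)
    then have "I = (I \<inter> ground M) \<union> (I \<inter> T)" by auto
    with that iff[of "I \<inter> ground M" "I \<inter> T"] show ?thesis by (metis inf_le2)
  qed
  have join: "X \<union> Y \<in> indeps ?F"
    if "X \<in> indeps M" "Y \<subseteq> B" "card X + card Y \<le> rank M (X \<union> A)" for X Y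
    using that iff[OF matroid_indep_subset_ground[OF M that(1)], of Y] B by simp
  have fB: "finite Y" if "Y \<subseteq> B" for Y using that B T by (meson finite_subset)
  show ?thesis
  proof (rule matroidI)
    show "finite (ground ?F)" using M T by (auto simp: gr matroid_def)
    show "I \<subseteq> ground ?F" if "I \<in> indeps ?F" for I using split[OF that] gr by blast
    show "{} \<in> indeps ?F" using join[of "{}" "{}"] matroid_empty[OF M] by simp
  next
    fix I J assume I: "I \<in> indeps ?F" and JI: "J \<subseteq> I"
    obtain X Y where XY: "I = X \<union> Y" "X \<subseteq> ground M" "Y \<subseteq> T" "X \<in> indeps M" "Y \<subseteq> B"
      "card X + card Y \<le> rank M (X \<union> A)" using split[OF I] by blast
    define X' Y' where "X' = J \<inter> X" and "Y' = J \<inter> Y"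
    have J: "J = X' \<union> Y'" using XY JI by (auto simp: X'_def Y'_def)
    have X': "X' \<in> indeps M" using matroid_indep_mono[OF M XY(4)] by (auto simp: X'_def)
    obtain Q where Q: "Q \<in> indeps M" "Q \<subseteq> X \<union> A" "card Q = rank M (X \<union> A)"
      "X \<subseteq> Q"
      using indep_extend_rank[OF M XY(4), of "X \<union> A"] by (metis Un_upper1)
    have fQ: "finite Q" "finite X" using matroid_finite_indep[OF M] Q XY by auto
    \<comment> \<open>Discarding elements of \<open>X\<close> lowers the rank of
      \<open>X \<union> A\<close> by at most their number, so the bound survives.\<close>
    have "Q - (X - X') \<in> indeps M" "Q - (X - X') \<subseteq> X' \<union> A"
      using matroid_indep_mono[OF M Q(1)] Q by auto
    then have "card (Q - (X - X')) \<le> rank M (X' \<union> A)" by (rule card_le_rank[OF M])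
    moreover have "card (Q - (X - X')) = card Q - card (X - X')"
      using fQ Q by (intro card_Diff_subset) auto
    moreover have "card (X - X') = card X - card X'" "card X' \<le> card X"
      using fQ by (auto simp: X'_def intro!: card_Diff_subset card_mono)
    moreover have "card Y' \<le> card Y" using fB[OF XY(5)] by (auto simp: Y'_def intro: card_mono)
    ultimately have "card X' + card Y' \<le> rank M (X' \<union> A)" using XY Q by linarith
    moreover have "Y' \<subseteq> B" using XY by (auto simp: Y'_def)
    ultimately show "J \<in> indeps ?F" unfolding J by (intro join X')
  next
    fix I J assume I: "I \<in> indeps ?F" and J: "J \<in> indeps ?F" and less: "card I < card J"
    obtain X1 Y1 where 1: "I = X1 \<union> Y1" "X1 \<subseteq> ground M" "Y1 \<subseteq> T" "X1 \<in> indeps M" "Y1 \<subseteq> B"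
      "card X1 + card Y1 \<le> rank M (X1 \<union> A)" using split[OF I] by blast
    obtain X2 Y2 where 2: "J = X2 \<union> Y2" "X2 \<subseteq> ground M" "Y2 \<subseteq> T" "X2 \<in> indeps M" "Y2 \<subseteq> B"
      "card X2 + card Y2 \<le> rank M (X2 \<union> A)" using split[OF J] by blast
    note fin = matroid_finite_indep[OF M] fB
    have cI: "card I = card X1 + card Y1" and cJ: "card J = card X2 + card Y2"
      using 1 2 T fin by (auto intro!: card_Un_disjoint)
    show "\<exists>x\<in>J - I. insert x I \<in> indeps ?F"
    \<comment> \<open>If the bound is tight for \<open>I\<close>, the new element has to raise the
      rank. Otherwise there is slack for one more element, and any element of \<open>B\<close>, or
      any element that keeps \<open>X1\<close> independent, will do.\<close>
    proof (cases "card X1 + card Y1 = rank M (X1 \<union> A)")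
      case True
      obtain Q1 where Q1: "Q1 \<in> indeps M" "X1 \<subseteq> Q1" "Q1 \<subseteq> X1 \<union> A" "card Q1 = rank M (X1 \<union> A)"
        using indep_extend_rank[OF M 1(4), of "X1 \<union> A"] by (metis Un_upper1)
      obtain Q2 where Q2: "Q2 \<in> indeps M" "Q2 \<subseteq> X2 \<union> A" "card Q2 = rank M (X2 \<union> A)"
        using rank_attained[OF M] .
      have "card Q1 < card Q2" using True less cI cJ 2 Q1 Q2 by linarith
      then obtain x where x: "x \<in> Q2 - Q1" "insert x Q1 \<in> indeps M"
        using matroid_augment[OF M Q1(1) Q2(1)] by auto
      \<comment> \<open>\<open>Q1\<close> is maximal in \<open>X1 \<union> A\<close>, so
        \<open>x\<close> lies outside; coming from \<open>Q2\<close>, it must belong to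
        \<open>X2\<close>, and it raises the rank along with the cardinality.\<close>
      have xA: "x \<notin> X1 \<union> A"
        using indep_maximal[OF M Q1(1,4) x(2)] x Q1 by auto
      have ix: "insert x X1 \<in> indeps M"
        by (rule matroid_indep_mono[OF M x(2)]) (use Q1 in auto)
      have "card (insert x Q1) \<le> rank M (insert x X1 \<union> A)"
        using x Q1 by (intro card_le_rank[OF M]) auto
      moreover have "card (insert x Q1) = Suc (card Q1)" "card (insert x X1) = Suc (card X1)"
        using x xA fin Q1 1 by auto
      ultimately have "card (insert x X1) + card Y1 \<le> rank M (insert x X1 \<union> A)"
        using True Q1 by linarith
      moreover have xX2: "x \<in> X2" using x Q2 xA by auto
      ultimately have "insert x X1 \<union> Y1 \<in> indeps ?F"
        using ix 1 by (intro join)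
      moreover have "x \<in> J - I" using xX2 xA 1 2 T by auto
      ultimately show ?thesis using 1 by auto
    next
      case False
      show ?thesis
      proof (cases "Y2 \<subseteq> Y1")
        case True
        \<comment> \<open>Here the surplus of \<open>J\<close> must come from
          \<open>X2\<close>.\<close>
        have "card Y2 \<le> card Y1" using True fin 1 by (auto intro: card_mono)
        then have "card X1 < card X2" using less cI cJ by linarith
        then obtain x where x: "x \<in> X2 - X1" "insert x X1 \<in> indeps M"
          using matroid_augment[OF M 1(4) 2(4)] by auto
        have "rank M (X1 \<union> A) \<le> rank M (insert x X1 \<union> A)"
          by (rule rank_mono[OF M]) auto
        moreover have "card (insert x X1) = Suc (card X1)" using x fin 1 by auto
        ultimately have "card (insert x X1) + card Y1 \<le> rank M (insert x X1 \<union> A)"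
          using False 1 by linarith
        then have "insert x X1 \<union> Y1 \<in> indeps ?F" using x 1 by (intro join)
        moreover have "x \<in> J - I" using x 1 2 T by auto
        ultimately show ?thesis using 1 by auto
      next
        case F: False
        then obtain y where y: "y \<in> Y2 - Y1" by auto
        then have "card (insert y Y1) = Suc (card Y1)" using fin 1 by auto
        then have "card X1 + card (insert y Y1) \<le> rank M (X1 \<union> A)"
          using False 1 by linarith
        then have "X1 \<union> insert y Y1 \<in> indeps ?F" using 1 2 y by (intro join) auto
        moreover have "y \<in> J - I" using y 1 2 T by auto
        ultimately show ?thesis using 1 by auto
      qed
    qed
  qed
qed

text \<open>The elements of \<open>Y\<close> act as stand-ins for the set \<open>W\<close> of elements of \<open>A\<close>.\<close>

lemma indep_free_extension_witness:
  assumes M: "matroid M" and T: "finite T" "ground M \<inter> T = {}" and B: "B \<subseteq> T"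
  shows "I \<in> indeps (free_extension M T A B) \<longleftrightarrow>
    (\<exists>X W Y. I = X \<union> Y \<and> X \<union> W \<in> indeps M \<and> X \<inter> W = {} \<and> W \<subseteq> A \<and> Y \<subseteq> B \<and> card Y = card W)"
    (is "_ \<longleftrightarrow> ?R")
proof
  assume I: "I \<in> indeps (free_extension M T A B)"
  define X Y where "X = I \<inter> ground M" and "Y = I \<inter> T"
  have IXY: "I = X \<union> Y"
    using I by (auto simp: X_def Y_def free_extension_def matroid_of_rank_def)
  have XY: "X \<in> indeps M" "Y \<subseteq> B" "card X + card Y \<le> rank M (X \<union> A)"
    using iffD1[OF indep_free_extension_iff[OF M T B], of X Y A] I
    unfolding IXY[symmetric] by (auto simp: X_def Y_def)
  \<comment> \<open>The set \<open>W\<close> is taken from a maximal independent extension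
    \<open>Q\<close> of \<open>X\<close> within \<open>X \<union> A\<close>; the bound leaves at
    least \<open>card Y\<close> elements in \<open>Q - X\<close>.\<close>
  obtain Q where Q: "Q \<in> indeps M" "X \<subseteq> Q" "Q \<subseteq> X \<union> A" "card Q = rank M (X \<union> A)"
    using indep_extend_rank[OF M XY(1), of "X \<union> A"] by (metis Un_upper1)
  have "card (Q - X) = card Q - card X"
    using Q matroid_finite_indep[OF M XY(1)] by (intro card_Diff_subset) auto
  then have "card Y \<le> card (Q - X)" using XY Q by linarith
  then obtain W where W: "W \<subseteq> Q - X" "card W = card Y"
    by (meson obtain_subset_with_card_n)
  have "X \<union> W \<in> indeps M"
    by (rule matroid_indep_mono[OF M Q(1)]) (use Q W in auto)
  moreover have "W \<subseteq> A" "X \<inter> W = {}" using W Q by auto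
  ultimately show ?R using IXY XY(2) W(2) by (intro exI[of _ X] exI[of _ W] exI[of _ Y]) simp
next
  assume ?R
  then obtain X W Y where I: "I = X \<union> Y" "X \<union> W \<in> indeps M" "X \<inter> W = {}" "W \<subseteq> A" "Y \<subseteq> B"
    "card Y = card W" by blast
  have X: "X \<in> indeps M" using matroid_indep_mono[OF M I(2)] by auto
  have "card (X \<union> W) = card X + card W"
    using I matroid_finite_indep[OF M I(2)] by (intro card_Un_disjoint) auto
  moreover have "card (X \<union> W) \<le> rank M (X \<union> A)"
    using I by (intro card_le_rank[OF M]) auto
  moreover have "X \<subseteq> ground M" using matroid_indep_subset_ground[OF M X] .
  ultimately show "I \<in> indeps (free_extension M T A B)"
    using indep_free_extension_iff[OF M T B, of X Y A] X I B by auto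
qed

section \<open>The principal sum\<close>

lemma direct_sum_loops:
  assumes "matroid N" "finite S"
  shows "direct_sum N (uniform_matroid 0 S) = \<lparr>ground = ground N \<union> S, indeps = indeps N\<rparr>"
proof -
  \<comment> \<open>Finiteness matters: \<open>card\<close> is 0 on infinite sets, so an infinite
    \<open>S\<close> would admit further sets here.\<close>
  have "{I. I \<subseteq> S \<and> card I = 0} = {{}}"
    using assms(2) by (auto dest: finite_subset)
  then show ?thesis by (simp add: direct_sum_def uniform_matroid_def)
qed

context
  fixes M N :: "'a set_system" and A B :: "'a set"
  assumes M: "matroid M" and N: "matroid N" and disj: "ground M \<inter> ground N = {}"
    and A: "A \<subseteq> ground M" and B: "B \<subseteq> ground N"
begin

lemma ground_principal_sum: "ground (principal_sum M N A B) = ground M \<union> ground N"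
  by (auto simp: principal_sum_def matroid_union_def ground_free_extension direct_sum_def
      uniform_matroid_def)

lemma principal_sum_matroid: "matroid (principal_sum M N A B)"
proof -
  have fin: "finite (ground M)" "finite (ground N)" using M N by (auto simp: matroid_def)
  have "matroid \<lparr>ground = ground N \<union> ground M, indeps = indeps N\<rparr>"
    using N fin by (auto simp: matroid_def)
  then show ?thesis
    unfolding principal_sum_def direct_sum_loops[OF N fin(1)]
    by (intro matroid_union_matroid free_extension_matroid M fin disj B)
qed

text \<open>From here on the rank function of the free extension is no longer consulted. The set
  \<open>Y\<close> stands in for \<open>W\<close>, and \<open>Y\<close> may overlap
  \<open>J\<close>.\<close>

lemma indep_principal_sum_iff:
  "I \<in> indeps (principal_sum M N A B) \<longleftrightarrow>
    (\<exists>X W Y J. I = X \<union> Y \<union> J \<and> X \<union> W \<in> indeps M \<and> X \<inter> W = {} \<and> W \<subseteq> A \<and> Y \<subseteq> B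
       \<and> card Y = card W \<and> J \<in> indeps N)"
proof -
  have fin: "finite (ground M)" "finite (ground N)" using M N by (auto simp: matroid_def)
  have "I \<in> indeps (principal_sum M N A B) \<longleftrightarrow>
      (\<exists>F J. I = F \<union> J \<and> F \<in> indeps (free_extension M (ground N) A B) \<and> J \<in> indeps N)"
    unfolding principal_sum_def direct_sum_loops[OF N fin(1)] by (auto simp: matroid_union_def)
  also have "\<dots> \<longleftrightarrow> (\<exists>F J X W Y. I = F \<union> J \<and> (F = X \<union> Y \<and> X \<union> W \<in> indeps M \<and> X \<inter> W = {}
      \<and> W \<subseteq> A \<and> Y \<subseteq> B \<and> card Y = card W) \<and> J \<in> indeps N)"
    unfolding indep_free_extension_witness[OF M fin(2) disj B] by (simp only: ex_simps)
  finally show ?thesis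
    by (simp only: conj_assoc)
      (intro iffI; elim exE conjE; hypsubst; intro exI conjI; (assumption | rule refl))
qed

lemma principal_sum_indepI:
  assumes "X \<union> W \<in> indeps M" "X \<inter> W = {}" "W \<subseteq> A" "Y \<subseteq> B" "card Y = card W" "J \<in> indeps N"
  shows "X \<union> Y \<union> J \<in> indeps (principal_sum M N A B)"
  using assms indep_principal_sum_iff by blast

text \<open>Disjointness of the ground sets fixes the trace \<open>X\<close> on \<open>M\<close> and
  the trace \<open>Y \<union> J\<close> on \<open>N\<close>; only \<open>W\<close> and the division
  of the latter trace are a matter of choice.\<close>

lemma principal_sum_indepE:
  assumes "I \<in> indeps (principal_sum M N A B)"
  obtains X W Y J where "I = X \<union> Y \<union> J" "X \<union> W \<in> indeps M" "X \<inter> W = {}" "W \<subseteq> A" "Y \<subseteq> B"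
    "card Y = card W" "J \<in> indeps N" "X = I \<inter> ground M" "Y \<union> J = I \<inter> ground N"
proof -
  obtain X W Y J where *: "I = X \<union> Y \<union> J" "X \<union> W \<in> indeps M" "X \<inter> W = {}" "W \<subseteq> A" "Y \<subseteq> B"
    "card Y = card W" "J \<in> indeps N"
    using assms unfolding indep_principal_sum_iff by (elim exE conjE)
  have "X \<subseteq> ground M" "J \<subseteq> ground N"
    using matroid_indep_subset_ground[OF M *(2)] matroid_indep_subset_ground[OF N *(7)] by auto
  then have "X = I \<inter> ground M" "Y \<union> J = I \<inter> ground N"
    using *(1,5) disj B by blast+
  then show ?thesis by (rule that[OF *])
qed

lemma principal_sum_Un_indep:
  "X \<in> indeps M \<Longrightarrow> J \<in> indeps N \<Longrightarrow> X \<union> J \<in> indeps (principal_sum M N A B)"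
  using principal_sum_indepI[of X "{}" "{}" J] by simp

text \<open>A set inside \<open>ground M\<close> is its own trace \<open>X\<close>, and
  \<open>X\<close> is independent because \<open>X \<union> W\<close> is.\<close>

lemma principal_sum_restrict:
  assumes "I \<subseteq> ground M"
  shows "I \<in> indeps (principal_sum M N A B) \<longleftrightarrow> I \<in> indeps M"
proof
  assume "I \<in> indeps (principal_sum M N A B)"
  then obtain X W Y J where *: "I = X \<union> Y \<union> J" "X \<union> W \<in> indeps M" "X \<inter> W = {}"
    "W \<subseteq> A" "Y \<subseteq> B" "card Y = card W" "J \<in> indeps N" "X = I \<inter> ground M"
    "Y \<union> J = I \<inter> ground N"
    by (rule principal_sum_indepE)
  have "X \<in> indeps M" by (rule matroid_indep_mono[OF M *(2)]) simp
  moreover have "X = I" using *(8) assms by auto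
  ultimately show "I \<in> indeps M" by simp
next
  assume "I \<in> indeps M"
  then show "I \<in> indeps (principal_sum M N A B)"
    using principal_sum_Un_indep[OF _ matroid_empty[OF N]] by fastforce
qed

text \<open>This is contraction by \<open>ground M\<close>, expressed through one basis. A basis
  \<open>D\<close> admits no further element, so \<open>W\<close> is empty and no stand-in
  occurs.\<close>

lemma principal_sum_contract:
  assumes D: "basis M D" and K: "K \<subseteq> ground N"
  shows "D \<union> K \<in> indeps (principal_sum M N A B) \<longleftrightarrow> K \<in> indeps N"
proof
  have DM: "D \<subseteq> ground M" using D M by (meson basis_def matroid_indep_subset_ground)
  assume "D \<union> K \<in> indeps (principal_sum M N A B)"
  then obtain X W Y J where *: "D \<union> K = X \<union> Y \<union> J" "X \<union> W \<in> indeps M" "X \<inter> W = {}"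
    "W \<subseteq> A" "Y \<subseteq> B" "card Y = card W" "J \<in> indeps N" "X = (D \<union> K) \<inter> ground M"
    "Y \<union> J = (D \<union> K) \<inter> ground N"
    by (rule principal_sum_indepE)
  have XD: "X = D" and YJ: "Y \<union> J = K" using *(8,9) DM K disj by auto
  have "X \<union> W = X" using *(2) D unfolding XD basis_def by blast
  then have "W = {}" using *(3) by auto
  \<comment> \<open>Without finiteness \<open>card Y = 0\<close> would not yield
    \<open>Y = {}\<close>.\<close>
  moreover have "finite Y"
    using *(5) B N by (meson matroid_def finite_subset)
  ultimately have "Y = {}" using *(6) by auto
  then show "K \<in> indeps N" using *(7) YJ by simp
next
  assume "K \<in> indeps N"
  then show "D \<union> K \<in> indeps (principal_sum M N A B)"
    using principal_sum_Un_indep D by (auto simp: basis_def)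
qed

text \<open>Stand-ins come from \<open>B\<close> and are as many as the elements of \<open>A\<close>
  they replace, so either set being empty rules them out. Hence both sets are nonempty once
  condition (1) fails.\<close>

lemma principal_sum_eq_direct_sum:
  assumes "A = {} \<or> B = {}"
  shows "principal_sum M N A B = direct_sum M N"
proof -
  have "indeps (principal_sum M N A B) = indeps (direct_sum M N)"
  proof (intro set_eqI iffI)
    fix I assume "I \<in> indeps (principal_sum M N A B)"
    then obtain X W Y J where *: "I = X \<union> Y \<union> J" "X \<union> W \<in> indeps M" "X \<inter> W = {}"
      "W \<subseteq> A" "Y \<subseteq> B" "card Y = card W" "J \<in> indeps N" "X = I \<inter> ground M"
      "Y \<union> J = I \<inter> ground N"
      by (rule principal_sum_indepE)
    have "finite Y" using *(5) B N by (meson matroid_def finite_subset)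
    then have "Y = {}" using assms *(4,5,6) by auto
    moreover have "X \<in> indeps M" using matroid_indep_mono[OF M *(2)] by auto
    ultimately show "I \<in> indeps (direct_sum M N)" using *(1,7) by (auto simp: direct_sum_def)
  next
    fix I assume "I \<in> indeps (direct_sum M N)"
    then show "I \<in> indeps (principal_sum M N A B)"
      using principal_sum_Un_indep by (auto simp: direct_sum_def)
  qed
  then show ?thesis
    using ground_principal_sum by (simp add: direct_sum_def)
qed

section \<open>Separators of the principal sum and their traces on the two matroids\<close>

lemma separator_principal_sumD:
  assumes "separator (principal_sum M N A B) Z"
    and "I \<in> indeps (principal_sum M N A B)" "J \<in> indeps (principal_sum M N A B)"
    and "I \<subseteq> Z" "J \<inter> Z = {}"
  shows "I \<union> J \<in> indeps (principal_sum M N A B)"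
  using separator_Un_indep[OF principal_sum_matroid assms(1,2,4,3)]
    matroid_indep_subset_ground[OF principal_sum_matroid assms(3)] assms(5) by blast

text \<open>Inside \<open>ground M\<close> independence is the same in both matroids, so the union
  property carries over.\<close>

lemma separator_principal_sum_restrict:
  assumes Z: "separator (principal_sum M N A B) Z"
  shows "separator M (Z \<inter> ground M)"
  unfolding separator_iff[OF M]
proof (intro conjI ballI impI)
  fix I J assume I: "I \<in> indeps M" "I \<subseteq> Z \<inter> ground M"
    and J: "J \<in> indeps M" "J \<subseteq> ground M - Z \<inter> ground M"
  then have "I \<in> indeps (principal_sum M N A B)" "J \<in> indeps (principal_sum M N A B)"
    using principal_sum_restrict[of I] principal_sum_restrict[of J] by auto
  then have "I \<union> J \<in> indeps (principal_sum M N A B)"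
    by (rule separator_principal_sumD[OF Z]) (use I(2) J(2) in auto)
  then show "I \<union> J \<in> indeps M" using principal_sum_restrict[of "I \<union> J"] I(2) J(2) by auto
qed auto

text \<open>Cut a basis \<open>D\<close> of \<open>M\<close> along \<open>Z\<close>:
  \<open>D \<inter> Z\<close> accompanies \<open>I\<close> and \<open>D - Z\<close> accompanies
  \<open>J\<close>. The union contains all of \<open>D\<close>, so contraction applies.\<close>

lemma separator_principal_sum_contract:
  assumes Z: "separator (principal_sum M N A B) Z"
  shows "separator N (Z \<inter> ground N)"
  unfolding separator_iff[OF N]
proof (intro conjI ballI impI)
  fix I J assume I: "I \<in> indeps N" "I \<subseteq> Z \<inter> ground N"
    and J: "J \<in> indeps N" "J \<subseteq> ground N - Z \<inter> ground N"
  let ?P = "principal_sum M N A B"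
  obtain D where D: "basis M D"
    using basis_extend[OF M matroid_empty[OF M]] by blast
  have DM: "D \<in> indeps M" "D \<subseteq> ground M"
    using D matroid_indep_subset_ground[OF M] by (auto simp: basis_def)
  have "(D \<inter> Z) \<union> I \<in> indeps ?P" "(D - Z) \<union> J \<in> indeps ?P"
    by (intro principal_sum_Un_indep I(1) J(1) matroid_indep_mono[OF M DM(1)]; blast)+
  then have "((D \<inter> Z) \<union> I) \<union> ((D - Z) \<union> J) \<in> indeps ?P"
    by (rule separator_principal_sumD[OF Z]) (use I(2) J(2) in auto)
  moreover have "((D \<inter> Z) \<union> I) \<union> ((D - Z) \<union> J) = D \<union> (I \<union> J)" by auto
  moreover have "I \<union> J \<subseteq> ground N" using I J by auto
  ultimately show "I \<union> J \<in> indeps N" using principal_sum_contract[OF D] by auto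
qed auto

lemma no_crossing_separator:
  assumes Z: "separator (principal_sum M N A B) Z"
    and noloop: "\<nexists>e. loop M e" and nocoloop: "\<nexists>e. coloop N e"
    and e: "e \<in> A" "e \<notin> Z" and b: "b \<in> B" "b \<in> Z"
  shows False
proof -
  let ?P = "principal_sum M N A B"
  have "{e} \<in> indeps M" using noloop e A by (auto simp: loop_def)
  then obtain I where I: "basis M I" "e \<in> I"
    using basis_extend[OF M] by (metis insert_subset)
  have IM: "I \<in> indeps M" "I \<subseteq> ground M"
    using I matroid_indep_subset_ground[OF M] by (auto simp: basis_def)
  obtain J where J: "basis N J" "b \<notin> J"
    using nocoloop b B by (auto simp: coloop_def)
  have JN: "J \<in> indeps N" "J \<subseteq> ground N"
    using J matroid_indep_subset_ground[OF N] by (auto simp: basis_def)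
  define C where "C = insert b (J \<inter> Z)"
  have CN: "C \<subseteq> ground N" "C \<subseteq> Z" using JN b B by (auto simp: C_def)
  have "J \<inter> Z \<in> indeps N" using matroid_indep_mono[OF N JN(1)] by auto
  \<comment> \<open>The decomposition has \<open>X = I - {e}\<close>, \<open>W = {e}\<close> and
    \<open>Y = {b}\<close>.\<close>
  then have "(I - {e}) \<union> {b} \<union> (J \<inter> Z) \<in> indeps ?P"
    using IM I e b by (intro principal_sum_indepI[of _ "{e}"]) (auto simp: insert_absorb)
  then have 1: "(I \<inter> Z) \<union> C \<in> indeps ?P"
    by (rule matroid_indep_mono[OF principal_sum_matroid]) (use e in \<open>auto simp: C_def\<close>)
  have "I - Z \<in> indeps M" by (rule matroid_indep_mono[OF M IM(1)]) auto
  then have 2: "I - Z \<in> indeps ?P"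
    using principal_sum_restrict[of "I - Z"] IM(2) by auto
  \<comment> \<open>Joining \<open>I - Z\<close> across the separator brings \<open>e\<close> back,
    although \<open>b\<close> has already taken its place.\<close>
  have "((I \<inter> Z) \<union> C) \<union> (I - Z) \<in> indeps ?P"
    by (rule separator_principal_sumD[OF Z 1 2]) (use CN(2) in auto)
  moreover have "((I \<inter> Z) \<union> C) \<union> (I - Z) = I \<union> C" by auto
  ultimately have "C \<in> indeps N" using principal_sum_contract[OF I(1) CN(1)] by simp
  moreover have "J - Z \<in> indeps N" using matroid_indep_mono[OF N JN(1)] by auto
  \<comment> \<open>The trace of \<open>Z\<close> separates \<open>N\<close>, so
    \<open>J - Z\<close> may rejoin \<open>C\<close>.\<close>
  ultimately have "C \<union> (J - Z) \<in> indeps N"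
    using CN JN(2)
    by (intro separator_Un_indep[OF N separator_principal_sum_contract[OF Z], of C "J - Z"]) auto
  moreover have "C \<union> (J - Z) = insert b J" by (auto simp: C_def)
  ultimately show False using J by (auto simp: basis_def)
qed

section \<open>Separators produced by each of the four conditions\<close>

lemma separator_principal_sumI:
  assumes "Z \<subseteq> ground M \<union> ground N"
    and "\<And>I J. I \<in> indeps (principal_sum M N A B) \<Longrightarrow> J \<in> indeps (principal_sum M N A B) \<Longrightarrow>
       I \<subseteq> Z \<Longrightarrow> J \<inter> Z = {} \<Longrightarrow> I \<union> J \<in> indeps (principal_sum M N A B)"
  shows "separator (principal_sum M N A B) Z"
  unfolding separator_iff[OF principal_sum_matroid] ground_principal_sum
  using assms by blast

text \<open>By restriction \<open>e\<close> is still a loop of the sum, so the side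
  \<open>{e}\<close> contributes only the empty set.\<close>

lemma separator_principal_sum_loop:
  assumes "loop M e"
  shows "separator (principal_sum M N A B) {e}"
proof (rule separator_principal_sumI)
  show "{e} \<subseteq> ground M \<union> ground N" using assms by (auto simp: loop_def)
  fix I J assume "I \<in> indeps (principal_sum M N A B)" "J \<in> indeps (principal_sum M N A B)"
    "I \<subseteq> {e}"
  then show "I \<union> J \<in> indeps (principal_sum M N A B)"
    using principal_sum_restrict[of "{e}"] assms by (auto simp: loop_def subset_singleton_iff)
qed

text \<open>The coloop can be added to the \<open>N\<close>-part of any decomposition.\<close>

lemma separator_principal_sum_coloop:
  assumes e: "coloop N e"
  shows "separator (principal_sum M N A B) {e}"
proof (rule separator_principal_sumI)
  let ?P = "principal_sum M N A B"
  show "{e} \<subseteq> ground M \<union> ground N" using assms by (auto simp: coloop_def)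
  fix I J assume I: "I \<subseteq> {e}" and J: "J \<in> indeps ?P"
  from J obtain X W Y K where *: "J = X \<union> Y \<union> K" "X \<union> W \<in> indeps M" "X \<inter> W = {}"
    "W \<subseteq> A" "Y \<subseteq> B" "card Y = card W" "K \<in> indeps N" "X = J \<inter> ground M"
    "Y \<union> K = J \<inter> ground N"
    by (rule principal_sum_indepE)
  from *(2-6) coloop_insert_indep[OF N e *(7)]
  have "X \<union> Y \<union> insert e K \<in> indeps ?P"
    by (rule principal_sum_indepI)
  then show "I \<union> J \<in> indeps ?P"
    by (rule matroid_indep_mono[OF principal_sum_matroid]) (use I *(1) in auto)
qed

text \<open>The separator is taken on the side of \<open>X\<close> that avoids \<open>A\<close>. The
  trace of \<open>J\<close> and the replaced set \<open>W\<close> both lie in \<open>X\<close>, so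
  \<open>I\<close> joins them in \<open>M\<close> without disturbing the stand-ins.\<close>

lemma separator_principal_sum_left:
  assumes X: "separator M X" "A \<subseteq> X"
  shows "separator (principal_sum M N A B) (ground M - X)"
proof (rule separator_principal_sumI)
  let ?P = "principal_sum M N A B"
  show "ground M - X \<subseteq> ground M \<union> ground N" by auto
  fix I J assume I: "I \<in> indeps ?P" "I \<subseteq> ground M - X"
    and J: "J \<in> indeps ?P" "J \<inter> (ground M - X) = {}"
  have IM: "I \<in> indeps M" using I principal_sum_restrict[of I] by auto
  from J(1) obtain X1 W Y K where *: "J = X1 \<union> Y \<union> K" "X1 \<union> W \<in> indeps M" "X1 \<inter> W = {}"
    "W \<subseteq> A" "Y \<subseteq> B" "card Y = card W" "K \<in> indeps N" "X1 = J \<inter> ground M"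
    "Y \<union> K = J \<inter> ground N"
    by (rule principal_sum_indepE)
  have "X1 \<union> W \<subseteq> X" using *(4,8) J(2) X by auto
  then have "(X1 \<union> W) \<union> I \<in> indeps M"
    using separator_Un_indep[OF M X(1) *(2) _ IM I(2)] by blast
  then have "(I \<union> X1) \<union> W \<in> indeps M" by (simp add: Un_ac)
  moreover have "(I \<union> X1) \<inter> W = {}" using *(3,4) I(2) X(2) by auto
  ultimately have "(I \<union> X1) \<union> Y \<union> K \<in> indeps ?P"
    using *(4-7) by (rule principal_sum_indepI)
  then show "I \<union> J \<in> indeps ?P" using *(1) by (simp add: Un_assoc)
qed

text \<open>Stand-ins lie in \<open>B\<close>, hence outside \<open>Y\<close>. So \<open>I\<close>
  is independent in \<open>N\<close> itself, and only the \<open>N\<close>-part \<open>K\<close> of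
  \<open>J\<close> has to absorb it.\<close>

lemma separator_principal_sum_right:
  assumes Y: "separator N Y" "Y \<inter> B = {}"
  shows "separator (principal_sum M N A B) Y"
proof (rule separator_principal_sumI)
  let ?P = "principal_sum M N A B"
  show YN: "Y \<subseteq> ground M \<union> ground N" using Y by (auto simp: separator_def)
  fix I J assume I: "I \<in> indeps ?P" "I \<subseteq> Y" and J: "J \<in> indeps ?P" "J \<inter> Y = {}"
  have IN: "I \<in> indeps N"
  proof -
    from I(1) obtain X1 W Y1 K where *: "I = X1 \<union> Y1 \<union> K" "X1 \<union> W \<in> indeps M" "X1 \<inter> W = {}"
      "W \<subseteq> A" "Y1 \<subseteq> B" "card Y1 = card W" "K \<in> indeps N" "X1 = I \<inter> ground M"
      "Y1 \<union> K = I \<inter> ground N"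
      by (rule principal_sum_indepE)
    have "X1 = {}" using *(8) I(2) Y(1) disj by (auto simp: separator_def)
    moreover have "Y1 = {}" using *(1,5) I(2) Y(2) by auto
    ultimately show ?thesis using *(1,7) by simp
  qed
  from J(1) obtain X W Y1 K where *: "J = X \<union> Y1 \<union> K" "X \<union> W \<in> indeps M" "X \<inter> W = {}"
    "W \<subseteq> A" "Y1 \<subseteq> B" "card Y1 = card W" "K \<in> indeps N" "X = J \<inter> ground M"
    "Y1 \<union> K = J \<inter> ground N"
    by (rule principal_sum_indepE)
  have "K \<subseteq> ground N - Y"
    using matroid_indep_subset_ground[OF N *(7)] *(1) J(2) by auto
  then have "I \<union> K \<in> indeps N"
    using separator_Un_indep[OF N Y(1) IN I(2) *(7)] by blast
  with *(2-6) have "X \<union> Y1 \<union> (I \<union> K) \<in> indeps ?P"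
    by (rule principal_sum_indepI)
  moreover have "X \<union> Y1 \<union> (I \<union> K) = I \<union> J" using *(1) by auto
  ultimately show "I \<union> J \<in> indeps ?P" by simp
qed

text \<open>In a direct sum, an independent set avoiding \<open>ground M\<close> is independent in
  \<open>N\<close> and can be joined to any independent set of \<open>M\<close>.\<close>

lemma separator_direct_sum:
  assumes "principal_sum M N A B = direct_sum M N"
  shows "separator (principal_sum M N A B) (ground M)"
proof (rule separator_principal_sumI)
  let ?P = "principal_sum M N A B"
  fix I J assume I: "I \<in> indeps ?P" "I \<subseteq> ground M" and J: "J \<in> indeps ?P" "J \<inter> ground M = {}"
  obtain X K where XK: "J = X \<union> K" "X \<in> indeps M" "K \<in> indeps N"
    using J(1) unfolding assms by (auto simp: direct_sum_def)
  then have "J = K" using J(2) matroid_indep_subset_ground[OF M XK(2)] by auto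
  then show "I \<union> J \<in> indeps ?P"
    using XK(3) I principal_sum_restrict[OF I(2)] principal_sum_Un_indep by auto
qed auto

end

theorem theorem3p18:
  fixes M N P :: "'a set_system" and S T A B :: "'a set"
  assumes "matroid M" and "ground M = S"
    and "matroid N" and "ground N = T"
    and "S \<inter> T = {}" and "S \<noteq> {}" and "T \<noteq> {}"
    and "A \<subseteq> S" and "B \<subseteq> T"
    and "P = principal_sum M N A B"
  shows "disconnected P \<longleftrightarrow>
      P = direct_sum M N
    \<or> ((\<exists>e. loop M e) \<or> (\<exists>e. coloop N e))
    \<or> (A \<noteq> {} \<and> (\<exists>X. separator M X \<and> A \<subseteq> X \<and> X \<subset> S))
    \<or> (B \<noteq> {} \<and> (\<exists>Y. separator N Y \<and> Y \<noteq> {} \<and> Y \<inter> B = {}))"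
    (is "_ \<longleftrightarrow> ?sum \<or> ?loops \<or> ?left \<or> ?right")
proof -
  note S = assms(2) and T = assms(4) and ne = assms(6,7) and P = assms(10)
  have disj: "ground M \<inter> ground N = {}" and A: "A \<subseteq> ground M" and B: "B \<subseteq> ground N"
    using assms by auto
  note ctx = assms(1,3) disj A B
  have gP: "ground P = S \<union> T" using ground_principal_sum[OF ctx] P S T by simp
  have disc: "disconnected P" if "separator P Z" "Z \<noteq> {}" "Z \<noteq> S \<union> T" for Z
    using that gP by (auto simp: disconnected_def)
  \<comment> \<open>The separator given by a loop or coloop is proper because two disjoint nonempty
    sets contain at least two elements.\<close>
  have single: "{e} \<noteq> S \<union> T" for e
  proof
    assume "{e} = S \<union> T"
    then have "S = {e}" "T = {e}" using ne by (simp_all add: singleton_Un_iff)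
    with assms(5) show False by simp
  qed
  show ?thesis
  proof
    assume "disconnected P"
    then obtain Z where Z: "separator P Z" "Z \<noteq> {}" "Z \<noteq> S \<union> T" "Z \<subseteq> S \<union> T"
      using gP by (auto simp: disconnected_def separator_def)
    show "?sum \<or> ?loops \<or> ?left \<or> ?right"
    proof (rule ccontr)
      assume neg: "\<not> (?sum \<or> ?loops \<or> ?left \<or> ?right)"
      have AB: "A \<noteq> {}" "B \<noteq> {}"
        using principal_sum_eq_direct_sum[OF ctx] neg P by auto
      \<comment> \<open>Failure of (3) forces the trace on \<open>S\<close> of a separator
        containing \<open>A\<close> to be all of \<open>S\<close>.\<close>
      have full: "S \<subseteq> V" if V: "separator P V" "A \<subseteq> V" for V
      proof -
        have "separator M (V \<inter> S)"
          using separator_principal_sum_restrict[OF ctx] V P S by auto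
        then show ?thesis using neg AB V A S by blast
      qed
      \<comment> \<open>Failure of (4) makes a separator that meets \<open>T\<close> meet
        \<open>B\<close> as well; missing part of \<open>A\<close>, it would be a crossing
        one.\<close>
      have nocross: False if V: "separator P V" "V \<inter> T \<noteq> {}" "\<not> A \<subseteq> V" for V
      proof -
        have "separator N (V \<inter> T)"
          using separator_principal_sum_contract[OF ctx] V P T by auto
        then obtain b where "b \<in> B" "b \<in> V" using neg AB V by blast
        moreover obtain e where "e \<in> A" "e \<notin> V" using V by auto
        ultimately show False
          using no_crossing_separator[OF ctx, of V e b] V P neg by auto
      qed
      define Z' where "Z' = S \<union> T - Z"
      have Z': "separator P Z'" using separator_Diff[OF Z(1)] gP by (simp add: Z'_def)
      \<comment> \<open>If one of \<open>Z\<close> and its complement contains \<open>A\<close>, it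
        contains \<open>S\<close>, so the other is a nonempty subset of \<open>T\<close> and misses
        \<open>A\<close>. If neither contains \<open>A\<close>, one of them still meets
        \<open>T\<close>. Either way \<open>nocross\<close> applies.\<close>
      consider "A \<subseteq> Z" | "A \<subseteq> Z'" | "\<not> A \<subseteq> Z" "\<not> A \<subseteq> Z'" by blast
      then show False
      proof cases
        case 1
        then have "Z' \<inter> T \<noteq> {}" "\<not> A \<subseteq> Z'"
          using full[OF Z(1)] Z AB by (auto simp: Z'_def)
        then show False using nocross Z' by blast
      next
        case 2
        then have "Z \<inter> T \<noteq> {}" "\<not> A \<subseteq> Z"
          using full[OF Z'] Z AB by (auto simp: Z'_def)
        then show False using nocross Z by blast
      next
        case 3
        moreover have "Z \<inter> T \<noteq> {} \<or> Z' \<inter> T \<noteq> {}" using ne by (auto simp: Z'_def)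
        ultimately show False using nocross Z Z' by blast
      qed
    qed
  next
    assume "?sum \<or> ?loops \<or> ?left \<or> ?right"
    then consider ?sum | e where "loop M e" | e where "coloop N e" | ?left | ?right by iprover
    then show "disconnected P"
    proof cases
      case 1
      then have "separator P S" using separator_direct_sum[OF ctx] P S by simp
      then show ?thesis by (rule disc) (use ne assms(5) in auto)
    next
      case (2 e)
      have "separator P {e}" unfolding P by (rule separator_principal_sum_loop[OF ctx 2])
      then show ?thesis using single by (rule disc[OF _ insert_not_empty])
    next
      case (3 e)
      have "separator P {e}" unfolding P by (rule separator_principal_sum_coloop[OF ctx 3])
      then show ?thesis using single by (rule disc[OF _ insert_not_empty])
    next
      case 4
      then obtain X where X: "separator M X" "A \<subseteq> X" "X \<subset> S" by blast
      \<comment> \<open>This set is nonempty because \<open>X\<close> is a proper subset of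
        \<open>S\<close>, and it is not everything because it misses \<open>T\<close>.\<close>
      have "separator P (S - X)" using separator_principal_sum_left[OF ctx X(1,2)] P S by simp
      then show ?thesis by (rule disc) (use X(3) ne assms(5) in auto)
    next
      case 5
      then obtain Y where Y: "separator N Y" "Y \<noteq> {}" "Y \<inter> B = {}" by blast
      then have "Y \<subseteq> T" using T by (simp add: separator_def)
      have "separator P Y" using separator_principal_sum_right[OF ctx Y(1,3)] P by simp
      then show ?thesis by (rule disc[OF _ Y(2)]) (use \<open>Y \<subseteq> T\<close> ne assms(5) in auto)
    qed
  qed
qed

end
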